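(* Let $G=(V,E)$ be a finite simple graph with maximal degree $\Delta=\max_{v\in V}\deg(v)$. Suppose $G$ has $k$ separation vertices and, for every integer $d$ with $3<d\le\Delta$, $G$ has at least $2d+d^2+d^3+k\cdot(\Delta!)$ vertices of degree $d$. Then there exists a graph $H$ on $|V|$ vertices which is a disjoint union of regular graphs such that \[ d(G,H)\le 4(\Delta+1)!\cdot k+5\Delta^2. \]
   Context: All graphs are finite, simple and unweighted. A vertex $v$ of a graph is a separation vertex if it has a neighbor $w$ with $\deg(w)>\deg(v)$. A "disjoint union of regular graphs" means a graph every connected component of which is (degree-)regular; different components may have different degrees. For two graphs $G,H$ on the same number $n$ of vertices, with adjacency matrices $A(G),A(H)$, the distance is $d(G,H)=\frac12\min_{\pi\in S_n}\sum_{i,j=1}^n |A(G)_{i,j}-A(H)_{\pi(i),\pi(j)}|$, i.e. the minimum, over bijections between the vertex sets, of the number of unordered vertex pairs that are an edge in exactly one of the two graphs (the minimal number of edge additions/removals turning $G$ into a graph isomorphic to $H$). *)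

theory Defs
  imports Complex_Main "Graph_Theory.Digraph_Component"
begin

text \<open>
  Finite simple graphs are \<^locale>\<open>pair_graph\<close>s: an undirected edge is the pair of
  opposite arcs, so the degree of a vertex is its out-degree.
\<close>

definition vertex_degree :: "'a pair_pre_digraph \<Rightarrow> 'a \<Rightarrow> nat" where
  "vertex_degree G v = out_degree (with_proj G) v"

text \<open>The 0 only matters for the graph without vertices.\<close>

definition max_degree :: "'a pair_pre_digraph \<Rightarrow> nat" where
  "max_degree G = Max (insert 0 (vertex_degree G ` pverts G))"

definition separation_vertices :: "'a pair_pre_digraph \<Rightarrow> 'a set" where
  "separation_vertices G =
    {v \<in> pverts G. \<exists>w \<in> pverts G. (v, w) \<in> parcs G \<and> vertex_degree G w > vertex_degree G v}"

definition regular_graph :: "('a, 'b) pre_digraph \<Rightarrow> bool" where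
  "regular_graph C \<longleftrightarrow> (\<exists>d. \<forall>v \<in> verts C. out_degree C v = d)"

text \<open>
  In a symmetric digraph the strongly connected components \<^const>\<open>pre_digraph.sccs\<close>
  are the connected components of the undirected graph.
\<close>

definition disjoint_union_of_regular :: "'a pair_pre_digraph \<Rightarrow> bool" where
  "disjoint_union_of_regular G \<longleftrightarrow> (\<forall>C \<in> pre_digraph.sccs (with_proj G). regular_graph C)"

definition adjacency :: "'a pair_pre_digraph \<Rightarrow> 'a \<Rightarrow> 'a \<Rightarrow> real" where
  "adjacency G u v = (if (u, v) \<in> parcs G then 1 else 0)"

text \<open>
  Instead of numbering both vertex sets by \<open>1, \<dots>, n\<close> and permuting the indices, the
  minimum ranges over the bijections between the vertex sets. It is meaningful only for
  graphs with equally many vertices.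
\<close>

definition graph_dist :: "'a pair_pre_digraph \<Rightarrow> 'b pair_pre_digraph \<Rightarrow> real" where
  "graph_dist G H = 1/2 *
    Min {(\<Sum>u \<in> pverts G. \<Sum>v \<in> pverts G.
            \<bar>adjacency G u v - adjacency H (\<pi> u) (\<pi> v)\<bar>) | \<pi>.
         bij_betw \<pi> (pverts G) (pverts H)}"

lemma graph_dist_Min_well_defined:
  fixes G :: "'a pair_pre_digraph" and H :: "'b pair_pre_digraph"
  assumes fin: "finite (pverts G)" "finite (pverts H)"
    and card: "card (pverts G) = card (pverts H)"
  defines "S \<equiv> {(\<Sum>u \<in> pverts G. \<Sum>v \<in> pverts G.
            \<bar>adjacency G u v - adjacency H (\<pi> u) (\<pi> v)\<bar>) | \<pi>.
         bij_betw \<pi> (pverts G) (pverts H)}"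
  shows "finite S" "S \<noteq> {}"
proof -
  let ?E = "\<lambda>\<pi>. {(u, v) \<in> pverts G \<times> pverts G. ((u, v) \<in> parcs G) \<noteq> ((\<pi> u, \<pi> v) \<in> parcs H)}"
  have "(\<Sum>u \<in> pverts G. \<Sum>v \<in> pverts G. \<bar>adjacency G u v - adjacency H (\<pi> u) (\<pi> v)\<bar>)
      = real (card (?E \<pi>))" for \<pi>
  proof -
    have "(\<Sum>u \<in> pverts G. \<Sum>v \<in> pverts G. \<bar>adjacency G u v - adjacency H (\<pi> u) (\<pi> v)\<bar>)
        = (\<Sum>p \<in> pverts G \<times> pverts G. if p \<in> ?E \<pi> then 1 else 0)"
      unfolding sum.cartesian_product by (rule sum.cong) (auto simp: adjacency_def split: if_splits)
    also have "\<dots> = real (card ((pverts G \<times> pverts G) \<inter> ?E \<pi>))"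
      using fin by (subst sum.inter_restrict[symmetric]) auto
    also have "(pverts G \<times> pverts G) \<inter> ?E \<pi> = ?E \<pi>" by auto
    finally show ?thesis .
  qed
  moreover have "card (?E \<pi>) \<le> card (pverts G \<times> pverts G)" for \<pi>
    using fin by (intro card_mono) auto
  ultimately have "S \<subseteq> real ` {..card (pverts G \<times> pverts G)}"
    unfolding S_def by auto
  then show "finite S" by (rule finite_subset) simp
  show "S \<noteq> {}"
    using finite_same_card_bij[OF fin card] unfolding S_def by auto
qed

end

(* Deleting the edges between vertices of different degrees costs at most k * Delta edges and
   leaves, for each d, a graph on the vertices of degree d with some units of degree missing.
   If u and u' each miss a unit, take an edge xy with x outside the closed neighbourhood of u and y
   outside that of u', and replace xy by ux and u'y; such an edge exists as soon as there are
   more than 2 d^2 arcs. Two missing units are thus repaired by three edits. If a single unit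
   remains, then d is odd, and isolating the deficient vertex makes d - 1
   units missing, an even number.
   For d > 3 the hypothesis provides enough arcs; for d <= 3, a shortage of arcs makes it cheap
   to delete all of them. *)

theory Submission
  imports Defs
begin

section \<open>Degrees in symmetric relations\<close>

text \<open>Arcs are counted, so \<open>card E\<close> is twice the number of edges. For subregular
  \<open>E\<close> the difference \<open>d * card W - card E\<close> is the total number of missing
  degree units.\<close>

definition subregular :: "nat \<Rightarrow> 'a set \<Rightarrow> 'a rel \<Rightarrow> bool" where
  "subregular d W E \<longleftrightarrow> E \<subseteq> W \<times> W \<and> sym E \<and> irrefl E \<and> (\<forall>v\<in>W. card (E `` {v}) \<le> d)"

lemma card_eq_sum_degrees:
  assumes "finite W" "E \<subseteq> W \<times> UNIV" "finite E"
  shows "card E = (\<Sum>v\<in>W. card (E `` {v}))"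
proof -
  have "E = Sigma W (\<lambda>v. E `` {v})" using assms(2) by auto
  then have "card E = card (Sigma W (\<lambda>v. E `` {v}))" by simp
  also have "\<dots> = (\<Sum>v\<in>W. card (E `` {v}))"
    using assms by (intro card_SigmaI) (auto intro: finite_Image)
  finally show ?thesis .
qed

lemma card_sym_diff_triangle:
  assumes "finite A" "finite B" "finite C"
  shows "card (sym_diff A C) \<le> card (sym_diff A B) + card (sym_diff B C)"
proof -
  have "card (sym_diff A C) \<le> card (sym_diff A B \<union> sym_diff B C)"
    using assms by (intro card_mono) auto
  also have "\<dots> \<le> card (sym_diff A B) + card (sym_diff B C)" by (rule card_Un_le)
  finally show ?thesis .
qed

text \<open>An arc and its reverse are distinct and can be removed together. This parity is what
  excludes a leftover unit in \<open>subregular_isolate\<close>.\<close>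

lemma even_card_sym_irrefl:
  assumes "finite E" "sym E" "irrefl E"
  shows "even (card E)"
  using assms
proof (induction "card E" arbitrary: E rule: less_induct)
  case less
  show ?case
  proof (cases "E = {}")
    case False
    then obtain x y where xy: "(x, y) \<in> E" by auto
    then have yx: "(y, x) \<in> E" using less.prems(2) by (rule symD[rotated])
    have ne: "x \<noteq> y" using xy less.prems(3) by (auto simp: irrefl_def)
    define F where "F = E - {(x, y), (y, x)}"
    have E: "E = insert (x, y) (insert (y, x) F)" using xy yx by (auto simp: F_def)
    have fF: "finite F" using less.prems by (simp add: F_def)
    have c: "card E = card F + 2"
      unfolding E using fF ne by (simp add: F_def)
    have "sym F" "irrefl F" using less.prems by (auto simp: F_def sym_def irrefl_def)
    then have "even (card F)" using less.hyps[of F] c fF by simp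
    then show ?thesis using c by simp
  qed simp
qed

lemma subregular_finite: "subregular d W E \<Longrightarrow> finite W \<Longrightarrow> finite E"
  unfolding subregular_def by (blast intro: finite_subset[OF _ finite_cartesian_product])

lemma subregular_card:
  assumes "subregular d W E" "finite W"
  shows "card E = (\<Sum>v\<in>W. card (E `` {v}))"
  using assms subregular_finite[OF assms]
  by (intro card_eq_sum_degrees) (auto simp: subregular_def)

lemma subregular_card_le:
  assumes "subregular d W E" "finite W"
  shows "card E \<le> d * card W"
proof -
  have "(\<Sum>v\<in>W. card (E `` {v})) \<le> (\<Sum>v\<in>W. d)"
    using assms by (intro sum_mono) (auto simp: subregular_def)
  then show ?thesis using subregular_card[OF assms] by (simp add: mult.commute)
qed

text \<open>Every vertex other than \<open>u\<close> contributes at most \<open>d\<close>, so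
  \<open>u\<close> misses no more units than are missing in total: none if the total is 0, at most
  one if it is 1.\<close>

lemma subregular_card_split:
  assumes "subregular d W E" "finite W" "u \<in> W"
  shows "card E + d \<le> card (E `` {u}) + d * card W"
proof -
  have "card E = card (E `` {u}) + (\<Sum>v\<in>W - {u}. card (E `` {v}))"
    using assms by (simp add: subregular_card sum.remove)
  moreover have "(\<Sum>v\<in>W - {u}. card (E `` {v})) \<le> (\<Sum>v\<in>W - {u}. d)"
    using assms by (intro sum_mono) (auto simp: subregular_def)
  moreover have "card W = card (W - {u}) + 1"
    using assms by (metis Suc_eq_plus1 card_Suc_Diff1)
  ultimately show ?thesis by (simp add: algebra_simps)
qed

lemma subregular_full_imp_regular:
  assumes "subregular d W E" "finite W" "card E = d * card W" "u \<in> W"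
  shows "card (E `` {u}) = d"
  using subregular_card_split[OF assms(1,2,4)] assms by (auto simp: subregular_def)

text \<open>If only one vertex is deficient, it carries the whole deficiency of at least two units
  and can play both roles.\<close>

lemma subregular_deficient_pair:
  assumes sr: "subregular d W E" and fin: "finite W" and def: "card E + 2 \<le> d * card W"
  obtains u u' where "u \<in> W" "u' \<in> W" "card (E `` {u}) < d" "card (E `` {u'}) < d"
    "u = u' \<Longrightarrow> card (E `` {u}) + 2 \<le> d"
proof -
  have "\<exists>u\<in>W. card (E `` {u}) < d"
  proof (rule ccontr)
    assume "\<not> ?thesis"
    then have "(\<Sum>v\<in>W. d) \<le> (\<Sum>v\<in>W. card (E `` {v}))"
      by (intro sum_mono) (auto simp: not_less)
    then show False using def subregular_card[OF sr fin] by (simp add: mult.commute)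
  qed
  then obtain u where u: "u \<in> W" "card (E `` {u}) < d" by auto
  show thesis
  proof (cases "\<exists>u'\<in>W - {u}. card (E `` {u'}) < d")
    case True
    then show thesis using u that by blast
  next
    case False
    have "card E = card (E `` {u}) + (\<Sum>v\<in>W - {u}. card (E `` {v}))"
      using sr fin u by (simp add: subregular_card sum.remove)
    moreover have "(\<Sum>v\<in>W - {u}. d) \<le> (\<Sum>v\<in>W - {u}. card (E `` {v}))"
      using False by (intro sum_mono) (auto simp: not_less)
    ultimately have "card E \<ge> card (E `` {u}) + d * card (W - {u})" by (simp add: mult.commute)
    moreover have "card W = card (W - {u}) + 1"
      using u fin by (metis Suc_eq_plus1 card_Suc_Diff1)
    ultimately have "card (E `` {u}) + 2 \<le> d" using def by (simp add: algebra_simps)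
    then show thesis using u that by blast
  qed
qed

section \<open>Filling up a relation to a regular one\<close>

text \<open>One edge goes and two come, which makes 2 + 4 = 6 arcs. The vertices \<open>x\<close>
  and \<open>y\<close> trade one neighbour for another, while \<open>u\<close> and \<open>u'\<close>
  each gain one.\<close>

lemma subregular_swap:
  assumes sr: "subregular d W E" and fin: "finite W" and def: "card E + 2 \<le> d * card W"
    and large: "card E > 2 * d\<^sup>2"
  obtains E' where "subregular d W E'" "card E' = card E + 2" "card (sym_diff E E') \<le> 6"
proof -
  note [simp] = subregular_finite[OF sr fin]
  have sub: "E \<subseteq> W \<times> W" and sym: "sym E" and irr: "irrefl E"
    and deg: "\<And>v. v \<in> W \<Longrightarrow> card (E `` {v}) \<le> d"
    using sr by (auto simp: subregular_def)
  have finI[simp]: "finite (E `` X)" for X by (simp add: finite_Image)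
  obtain u u' where u: "u \<in> W" "u' \<in> W" "card (E `` {u}) < d" "card (E `` {u'}) < d"
    and uu: "u = u' \<Longrightarrow> card (E `` {u}) + 2 \<le> d"
    using subregular_deficient_pair[OF sr fin def] by blast
  \<comment> \<open>These are the arcs with tail in the closed neighbourhood of \<open>w\<close>.
    For deficient \<open>w\<close> that neighbourhood has at most \<open>d\<close> vertices, hence
    at most \<open>d * d\<close> arcs.\<close>
  define B where "B w = Sigma (insert w (E `` {w})) (\<lambda>x. E `` {x})" for w
  have B: "card (B w) \<le> d\<^sup>2" if "w \<in> W" "card (E `` {w}) < d" for w
  proof -
    have W: "insert w (E `` {w}) \<subseteq> W" using that sub by auto
    have "card (B w) = (\<Sum>x\<in>insert w (E `` {w}). card (E `` {x}))"
      unfolding B_def by (intro card_SigmaI) auto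
    also have "\<dots> \<le> (\<Sum>x\<in>insert w (E `` {w}). d)"
      using W deg by (intro sum_mono) auto
    also have "\<dots> = card (insert w (E `` {w})) * d" by simp
    also have "\<dots> \<le> d * d"
      using that(2) card_insert_le_m1[of d "E `` {w}" w] by (intro mult_right_mono) auto
    finally show ?thesis by (simp add: power2_eq_square)
  qed
  \<comment> \<open>The restriction for \<open>u\<close> concerns the tail \<open>x\<close>, the one
    for \<open>u'\<close> the head \<open>y\<close>; hence the converse in the second set.\<close>
  have "card (B u \<union> (B u')\<inverse>) \<le> card (B u) + card ((B u')\<inverse>)" by (rule card_Un_le)
  also have "\<dots> \<le> d\<^sup>2 + d\<^sup>2" using B u by (intro add_mono) (auto simp: card_inverse)
  finally have "card (B u \<union> (B u')\<inverse>) < card E" using large by simp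
  then have "\<not> E \<subseteq> B u \<union> (B u')\<inverse>"
    using card_mono[of "B u \<union> (B u')\<inverse>" E] by (auto simp: B_def)
  then obtain x y where xy: "(x, y) \<in> E" and nB: "(x, y) \<notin> B u" "(y, x) \<notin> B u'" by auto
  have yx: "(y, x) \<in> E" using xy sym by (auto dest: symD)
  have nx: "x \<noteq> u" "(u, x) \<notin> E" "(x, u) \<notin> E" and ny: "y \<noteq> u'" "(u', y) \<notin> E" "(y, u') \<notin> E"
    using nB xy yx sym by (auto simp: B_def dest: symD)
  have ne: "x \<noteq> y" using xy irr by (auto simp: irrefl_def)
  \<comment> \<open>\<open>u = y\<close> would make \<open>x\<close> a neighbour of
    \<open>u\<close>, and \<open>u' = x\<close> would make \<open>y\<close> a neighbour of
    \<open>u'\<close>.\<close>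
  have nu: "u \<noteq> y" "u' \<noteq> x" using xy yx nx ny by auto
  have xW: "x \<in> W" "y \<in> W" using xy sub by auto
  define F where "F = E - {(x, y), (y, x)}"
  define N where "N = {(u, x), (x, u), (u', y), (y, u')}"
  \<comment> \<open>The four arcs stay distinct even when \<open>u = u'\<close>, because
    \<open>x\<close> and \<open>y\<close> differ.\<close>
  have cN: "card N = 4" using nx ny ne nu by (auto simp: N_def)
  have dis: "F \<inter> N = {}" using nx ny by (auto simp: F_def N_def)
  have cF: "card E = card F + 2"
  proof -
    have "E = insert (x, y) (insert (y, x) F)" using xy yx by (auto simp: F_def)
    moreover have "card (insert (x, y) (insert (y, x) F)) = card F + 2"
      using ne by (simp add: F_def)
    ultimately show ?thesis by simp
  qed
  have fF: "finite F" "finite N" by (auto simp: F_def N_def)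
  \<comment> \<open>For the ends of the removed edge: \<open>w\<close> is the lost neighbour and
    \<open>z\<close> the gained one.\<close>
  have degx: "card ((F \<union> N) `` {v}) \<le> card (E `` {v})"
    if "(v, w) \<in> E" "(F \<union> N) `` {v} \<subseteq> insert z (E `` {v} - {w})" for v w z
  proof -
    have "card ((F \<union> N) `` {v}) \<le> card (insert z (E `` {v} - {w}))"
      using that(2) by (intro card_mono) auto
    also have "\<dots> \<le> Suc (card (E `` {v} - {w}))" by (rule card_insert_le_m1) auto
    also have "\<dots> = card (E `` {v})" using that(1) by (intro card_Suc_Diff1) auto
    finally show ?thesis .
  qed
  have degu: "card ((F \<union> N) `` {v}) \<le> card (E `` {v}) + card Z"
    if "(F \<union> N) `` {v} \<subseteq> E `` {v} \<union> Z" "finite Z" for v Z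
    using card_mono[OF _ that(1)] card_Un_le[of "E `` {v}" Z] that(2) by simp
  have "card ((F \<union> N) `` {v}) \<le> d" if v: "v \<in> W" for v
  proof -
    \<comment> \<open>If \<open>u = u'\<close>, this vertex gains both \<open>x\<close> and
      \<open>y\<close>, so it must miss two units; this is where \<open>uu\<close> enters.\<close>
    consider "v = x" | "v = y" | "v = u" "u = u'" | "v = u" "u \<noteq> u'" | "v = u'" "u \<noteq> u'"
      | "v \<notin> {x, y, u, u'}" by blast
    then show ?thesis
    proof cases
      case 1
      have "(F \<union> N) `` {x} \<subseteq> insert u (E `` {x} - {y})"
        using nx ny ne nu by (auto simp: F_def N_def)
      then show ?thesis using degx[OF xy] deg[OF v] 1 by fastforce
    next
      case 2
      have "(F \<union> N) `` {y} \<subseteq> insert u' (E `` {y} - {x})"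
        using nx ny ne nu by (auto simp: F_def N_def)
      then show ?thesis using degx[OF yx] deg[OF v] 2 by fastforce
    next
      case 3
      have "(F \<union> N) `` {v} \<subseteq> E `` {v} \<union> {x, y}"
        using nx ny ne nu 3 by (auto simp: F_def N_def)
      then show ?thesis using degu[of v "{x, y}"] uu 3 ne by simp
    next
      case 4
      have "(F \<union> N) `` {v} \<subseteq> E `` {v} \<union> {x}"
        using nx ny ne nu 4 by (auto simp: F_def N_def)
      then show ?thesis using degu[of v "{x}"] u 4 by simp
    next
      case 5
      have "(F \<union> N) `` {v} \<subseteq> E `` {v} \<union> {y}"
        using nx ny ne nu 5 by (auto simp: F_def N_def)
      then show ?thesis using degu[of v "{y}"] u 5 by simp
    next
      case 6
      then have "(F \<union> N) `` {v} \<subseteq> E `` {v} \<union> {}" by (auto simp: F_def N_def)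
      then show ?thesis using degu[of v "{}"] deg[OF v] by simp
    qed
  qed
  moreover have "sym (F \<union> N)" using sym by (auto simp: F_def N_def sym_def)
  moreover have "irrefl (F \<union> N)" using irr nx ny by (auto simp: F_def N_def irrefl_def)
  moreover have "F \<union> N \<subseteq> W \<times> W" using sub u xW by (auto simp: F_def N_def)
  ultimately have "subregular d W (F \<union> N)" by (simp add: subregular_def)
  moreover have "card (F \<union> N) = card E + 2"
    using card_Un_disjoint[OF fF dis] cN cF by simp
  moreover have "card (sym_diff E (F \<union> N)) \<le> 6"
  proof -
    have "sym_diff E (F \<union> N) \<subseteq> {(x, y), (y, x)} \<union> N" by (auto simp: F_def)
    then have "card (sym_diff E (F \<union> N)) \<le> card ({(x, y), (y, x)} \<union> N)"
      using fF by (intro card_mono) auto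
    moreover have "card ({(x, y), (y, x)} \<union> N) \<le> card {(x, y), (y, x)} + card N"
      by (rule card_Un_le)
    moreover have "card {(x, y), (y, x)} = 2" using ne by simp
    ultimately show ?thesis using cN by linarith
  qed
  ultimately show thesis by (rule that)
qed

text \<open>Each swap recovers two units and changes at most 6 arcs, hence the factor 3. The number
  of arcs only grows, so the size condition survives until at most one unit is missing.\<close>

lemma subregular_fill:
  assumes "subregular d W E" and fin: "finite W" and "card E > 2 * d\<^sup>2"
  shows "\<exists>E'. subregular d W E' \<and> d * card W \<le> card E' + 1 \<and> card E \<le> card E' \<and>
    card (sym_diff E E') \<le> 3 * (d * card W - card E)"
  using assms(1,3)
proof (induction "d * card W - card E" arbitrary: E rule: less_induct)
  case less
  show ?case
  proof (cases "card E + 2 \<le> d * card W")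
    case False
    then show ?thesis using less.prems by (intro exI[of _ E]) auto
  next
    case True
    obtain F where F: "subregular d W F" "card F = card E + 2" "card (sym_diff E F) \<le> 6"
      using subregular_swap[OF less.prems(1) fin True less.prems(2)] .
    have dec: "d * card W - card F < d * card W - card E" and big: "card F > 2 * d\<^sup>2"
      using F(2) True less.prems(2) by linarith+
    obtain E' where E': "subregular d W E'" "d * card W \<le> card E' + 1" "card F \<le> card E'"
      "card (sym_diff F E') \<le> 3 * (d * card W - card F)"
      using less.hyps[OF dec F(1) big] by blast
    have "card (sym_diff E E') \<le> card (sym_diff E F) + card (sym_diff F E')"
      using less.prems(1) F(1) E'(1) fin
      by (intro card_sym_diff_triangle) (auto dest: subregular_finite)
    then show ?thesis using E' F True by (intro exI[of _ E'] conjI) auto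
  qed
qed

text \<open>Removing the edges at \<open>v\<close> costs \<open>2 * (d - 1)\<close> arcs and
  refilling costs at most \<open>3 * (d - 1)\<close>, hence \<open>5 * d\<close>. The extra
  \<open>2 * d\<close> in the size condition pays for the removal, so that
  \<open>subregular_fill\<close> still applies.\<close>

lemma subregular_isolate:
  assumes sr: "subregular d W E" and fin: "finite W" and def: "card E + 1 = d * card W"
    and large: "card E > 2 * d\<^sup>2 + 2 * d"
  obtains v E' where "v \<in> W" "subregular d (W - {v}) E'" "card E' = d * card (W - {v})"
    "card (sym_diff E E') \<le> 5 * d"
proof -
  note fE[simp] = subregular_finite[OF sr fin]
  have sub: "E \<subseteq> W \<times> W" and sym: "sym E" and irr: "irrefl E"
    and deg: "\<And>v. v \<in> W \<Longrightarrow> card (E `` {v}) \<le> d"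
    using sr by (auto simp: subregular_def)
  have "\<exists>v\<in>W. card (E `` {v}) < d"
  proof (rule ccontr)
    assume "\<not> ?thesis"
    then have "(\<Sum>v\<in>W. d) \<le> (\<Sum>v\<in>W. card (E `` {v}))"
      by (intro sum_mono) (auto simp: not_less)
    then show False using def subregular_card[OF sr fin] by (simp add: mult.commute)
  qed
  then obtain v where v: "v \<in> W" "card (E `` {v}) < d" by auto
  have dv: "card (E `` {v}) + 1 = d"
    using subregular_card_split[OF sr fin v(1)] v(2) def by simp
  define R where "R = {v} \<times> (E `` {v}) \<union> (E `` {v}) \<times> {v}"
  define F where "F = E - R"
  have "R \<subseteq> E" using sym by (auto simp: R_def dest: symD)
  have nv: "v \<notin> E `` {v}" using irr by (auto simp: irrefl_def)
  have cR: "card R = 2 * card (E `` {v})"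
  proof -
    have "card R = card ({v} \<times> (E `` {v})) + card ((E `` {v}) \<times> {v})"
      unfolding R_def using nv by (intro card_Un_disjoint) (auto simp: finite_Image)
    then show ?thesis by (simp add: card_cartesian_product)
  qed
  have fR: "finite R" using \<open>R \<subseteq> E\<close> by (rule finite_subset) simp
  have cF: "card F + 2 * card (E `` {v}) = card E"
    using card_Diff_subset[OF fR \<open>R \<subseteq> E\<close>] card_mono[OF fE \<open>R \<subseteq> E\<close>] cR by (simp add: F_def)
  have srF: "subregular d (W - {v}) F"
    unfolding subregular_def
  proof (intro conjI ballI)
    show "F \<subseteq> (W - {v}) \<times> (W - {v})" using sub sym by (auto simp: F_def R_def dest: symD)
    show "sym F" using sym by (auto simp: F_def R_def sym_def)
    show "irrefl F" using irr by (auto simp: F_def irrefl_def)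
    fix w assume w: "w \<in> W - {v}"
    have "card (F `` {w}) \<le> card (E `` {w})"
      by (intro card_mono) (auto simp: F_def finite_Image)
    then show "card (F `` {w}) \<le> d" using deg[of w] w by simp
  qed
  have cW: "card W = card (W - {v}) + 1"
    using v fin by (metis Suc_eq_plus1 card_Suc_Diff1)
  \<comment> \<open>Only \<open>v\<close> was deficient, so on the remaining vertices the missing
    units are those lost by its neighbours, one each.\<close>
  have defF: "d * card (W - {v}) - card F = card (E `` {v})"
    using cF cW def dv by (simp add: algebra_simps)
  obtain E' where E': "subregular d (W - {v}) E'" "d * card (W - {v}) \<le> card E' + 1"
    "card (sym_diff F E') \<le> 3 * card (E `` {v})"
    using subregular_fill[OF srF] fin large cF dv unfolding defF by auto
  have fE': "finite E'" using E'(1) fin by (auto dest: subregular_finite)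
  \<comment> \<open>\<open>d * card W\<close> exceeds an even number by one, so \<open>d\<close> and
    \<open>card W\<close> are both odd. Then \<open>d * card (W - {v})\<close> is even, and the even
    number \<open>card E'\<close> cannot fall short of it by exactly one.\<close>
  have "even (card E)" using sym irr by (simp add: even_card_sym_irrefl)
  then have "odd (d * card W)" using def by (metis even_plus_one_iff)
  then have "even (d * card (W - {v}))" using cW by auto
  moreover have "even (card E')"
    using E'(1) fE' by (intro even_card_sym_irrefl) (auto simp: subregular_def)
  moreover have "card E' \<le> d * card (W - {v})"
    using subregular_card_le[OF E'(1)] fin by simp
  ultimately have full: "card E' = d * card (W - {v})"
    using E'(2) by presburger
  have "sym_diff E F = R" using \<open>R \<subseteq> E\<close> by (auto simp: F_def)
  then have "card (sym_diff E F) = 2 * card (E `` {v})" using cR by simp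
  moreover have "card (sym_diff E E') \<le> card (sym_diff E F) + card (sym_diff F E')"
    using fE' by (intro card_sym_diff_triangle) (auto simp: F_def)
  ultimately have "card (sym_diff E E') \<le> 5 * d" using E'(3) dv by linarith
  then show thesis using that[OF v(1) E'(1) full] by blast
qed

text \<open>Equal degrees at the ends of each arc, rather than \<open>d\<close>-regularity, is the
  right target: it admits the isolated vertex and the empty relation.\<close>

lemma subregular_repair:
  assumes sr: "subregular d W E" and fin: "finite W"
    and large: "d \<le> 3 \<or> card E > 2 * d\<^sup>2 + 2 * d"
  shows "\<exists>E'. E' \<subseteq> W \<times> W \<and> sym E' \<and> irrefl E' \<and>
    (\<forall>(x, y)\<in>E'. card (E' `` {x}) = card (E' `` {y})) \<and>
    card (sym_diff E E') \<le> 3 * (d * card W - card E) + 10 * d"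
proof (cases "card E > 2 * d\<^sup>2 + 2 * d")
  \<comment> \<open>All arcs are deleted. For \<open>d\<close> at most 3 their number is at most
    \<open>2 * (3 * d) + 2 * d\<close>, which is below the allowance \<open>10 * d\<close>.\<close>
  case False
  then have d: "d \<le> 3" and c: "card E \<le> 2 * d\<^sup>2 + 2 * d" using large by auto
  have "d\<^sup>2 \<le> 3 * d" using d by (simp add: power2_eq_square)
  then have "card E \<le> 10 * d" using c by simp
  then show ?thesis by (intro exI[of _ "{}"]) (auto simp: sym_def irrefl_def)
next
  case True
  obtain F where F: "subregular d W F" "d * card W \<le> card F + 1" "card E \<le> card F"
    "card (sym_diff E F) \<le> 3 * (d * card W - card E)"
    using subregular_fill[OF sr fin] True by auto
  have leF: "card F \<le> d * card W" using subregular_card_le[OF F(1) fin] .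
  show ?thesis
  proof (cases "card F = d * card W")
    case full: True
    have "card (F `` {x}) = card (F `` {y})" if "(x, y) \<in> F" for x y
    proof -
      have "x \<in> W" "y \<in> W" using F(1) that by (auto simp: subregular_def)
      then show ?thesis using subregular_full_imp_regular[OF F(1) fin full] by simp
    qed
    then show ?thesis using F by (intro exI[of _ F]) (auto simp: subregular_def)
  next
    case False
    then have F1: "card F + 1 = d * card W" using F(2) leF by simp
    have "card F > 2 * d\<^sup>2 + 2 * d" using True F(3) by simp
    then obtain v E' where E': "v \<in> W" "subregular d (W - {v}) E'"
      "card E' = d * card (W - {v})" "card (sym_diff F E') \<le> 5 * d"
      using subregular_isolate[OF F(1) fin F1] by blast
    have "card (E' `` {x}) = card (E' `` {y})" if "(x, y) \<in> E'" for x y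
    proof -
      have "x \<in> W - {v}" "y \<in> W - {v}" using E'(2) that by (auto simp: subregular_def)
      then show ?thesis
        using subregular_full_imp_regular[OF E'(2) _ E'(3)] fin by simp
    qed
    moreover have "card (sym_diff E E') \<le> card (sym_diff E F) + card (sym_diff F E')"
      using sr F(1) E'(2) fin
      by (intro card_sym_diff_triangle) (auto dest: subregular_finite)
    ultimately show ?thesis
      using E' F(4) by (intro exI[of _ E']) (auto simp: subregular_def)
  qed
qed

section \<open>From local regularity to regular components\<close>

lemma vertex_degree_eq_card_Image: "vertex_degree G v = card (parcs G `` {v})"
proof -
  have "out_arcs (with_proj G) v = Pair v ` (parcs G `` {v})" by (auto simp: out_arcs_def)
  then show ?thesis
    by (simp add: vertex_degree_def out_degree_def card_image inj_on_def)
qed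

text \<open>Equality of degrees spreads along paths. A component contains all neighbours of its
  vertices, so degrees in it agree with degrees in \<open>H\<close>.\<close>

lemma disjoint_union_of_regularI:
  assumes "pair_graph H"
    and loc: "\<And>x y. (x, y) \<in> parcs H \<Longrightarrow> vertex_degree H x = vertex_degree H y"
  shows "disjoint_union_of_regular H"
  unfolding disjoint_union_of_regular_def
proof
  interpret H: pair_graph H by fact
  fix C assume C: "C \<in> pre_digraph.sccs (with_proj H)"
  then have ind: "induced_subgraph C (with_proj H)" by (rule H.in_sccs_imp_induced)
  have S: "verts C \<in> pre_digraph.sccs_verts (with_proj H)"
    using C by (intro H.in_sccs_vertsI_sccs) auto
  note S' = S[unfolded H.in_sccs_verts_conv_reachable]
  have reach: "vertex_degree H u = vertex_degree H v" if "u \<rightarrow>\<^sup>*\<^bsub>with_proj H\<^esub> v" for u v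
    using that unfolding reachable_def
    by (induction rule: rtrancl_on_induct) (auto dest: loc)
  have closed: "w \<in> verts C" if "u \<in> verts C" "(u, w) \<in> parcs H" for u w
  proof -
    have "(w, u) \<in> parcs H" using that(2) H.pair_sym_arcs
      by (auto simp: symmetric_def dest: symD)
    then have "u \<rightarrow>\<^sup>*\<^bsub>with_proj H\<^esub> w" "w \<rightarrow>\<^sup>*\<^bsub>with_proj H\<^esub> u"
      using that(2) by (auto intro!: H.reachable_adjI)
    then show ?thesis using S' that(1) by blast
  qed
  have deg: "out_degree C u = vertex_degree H u" if "u \<in> verts C" for u
  proof -
    have "tail C = fst" and arcs: "arcs C = {e \<in> parcs H. fst e \<in> verts C \<and> snd e \<in> verts C}"
      using ind by (auto simp: induced_subgraph_def subgraph_def compatible_def)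
    then have "out_arcs C u = out_arcs (with_proj H) u"
      using closed that by (auto simp: out_arcs_def)
    then show ?thesis by (simp add: vertex_degree_def out_degree_def)
  qed
  have "vertex_degree H u = vertex_degree H v" if "u \<in> verts C" "v \<in> verts C" for u v
    using S' that reach by blast
  then show "regular_graph C" unfolding regular_graph_def using deg by metis
qed

text \<open>The identity is one of the bijections over which the minimum is taken. The sum counts
  arcs, hence the factor 1/2.\<close>

lemma graph_dist_same_verts_le:
  assumes "finite (pverts G)" and verts: "pverts H = pverts G"
    and sub: "parcs G \<subseteq> pverts G \<times> pverts G" "parcs H \<subseteq> pverts G \<times> pverts G"
  shows "graph_dist G H \<le> 1/2 * card (sym_diff (parcs G) (parcs H))"
proof -
  let ?W = "pverts G" and ?D = "sym_diff (parcs G) (parcs H)"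
  let ?f = "\<lambda>\<pi>. \<Sum>u\<in>?W. \<Sum>v\<in>?W. \<bar>adjacency G u v - adjacency H (\<pi> u) (\<pi> v)\<bar>"
  have "?f id = (\<Sum>p\<in>?W \<times> ?W. if p \<in> ?D then 1 else 0)"
    unfolding sum.cartesian_product by (rule sum.cong) (auto simp: adjacency_def split: if_splits)
  also have "\<dots> = real (card ((?W \<times> ?W) \<inter> ?D))"
    using assms(1) by (subst sum.inter_restrict[symmetric]) auto
  also have "(?W \<times> ?W) \<inter> ?D = ?D" using sub by auto
  finally have "?f id = real (card ?D)" .
  moreover have "Min {?f \<pi> | \<pi>. bij_betw \<pi> ?W (pverts H)} \<le> ?f id"
    using graph_dist_Min_well_defined(1)[of G H] assms(1) verts
    by (intro Min_le) (auto intro!: exI[of _ id])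
  ultimately show ?thesis unfolding graph_dist_def by simp
qed

section \<open>Splitting the graph by degree and repairing each class\<close>

theorem theorem1:
  fixes G :: "'a pair_pre_digraph" and k \<Delta> :: nat
  assumes "pair_graph G"
    and "\<Delta> = max_degree G"
    and "k = card (separation_vertices G)"
    and "\<And>d::nat. 3 < d \<Longrightarrow> d \<le> \<Delta> \<Longrightarrow>
      card {v \<in> pverts G. vertex_degree G v = d} \<ge> 2 * d + d ^ 2 + d ^ 3 + k * fact \<Delta>"
  shows "\<exists>H :: 'a pair_pre_digraph.
    pair_graph H \<and> card (pverts H) = card (pverts G) \<and> disjoint_union_of_regular H \<and>
    graph_dist G H \<le> 4 * fact (\<Delta> + 1) * real k + 5 * real \<Delta> ^ 2"
proof -
  interpret G: pair_graph G by fact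
  define A where "A = parcs G"
  define W where "W = pverts G"
  define dg where "dg v = card (A `` {v})" for v
  define V where "V d = {v \<in> W. dg v = d}" for d
  define E where "E d = A \<inter> V d \<times> V d" for d
  define X where "X = {(x, y) \<in> A. dg x \<noteq> dg y}"
  have vd: "vertex_degree G v = dg v" for v
    by (simp add: dg_def A_def vertex_degree_eq_card_Image)
  have finW[simp]: "finite W" and finA[simp]: "finite A"
    by (auto simp: W_def A_def G.pair_finite_verts G.pair_finite_arcs)
  have sub: "A \<subseteq> W \<times> W" by (auto simp: A_def W_def dest: G.in_arcsD1 G.in_arcsD2)
  have sym: "sym A" using G.pair_sym_arcs by (simp add: A_def symmetric_def)
  have irr: "irrefl A" using G.pair_no_loops by (force simp: A_def irrefl_def)
  have finI[simp]: "finite (A `` Y)" for Y by (simp add: finite_Image)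
  have finX[simp]: "finite X" by (rule finite_subset[of _ A]) (auto simp: X_def)
  have finV[simp]: "finite (V d)" for d by (simp add: V_def)
  have finE[simp]: "finite (E d)" for d by (simp add: E_def)
  have dgle: "dg v \<le> \<Delta>" if "v \<in> W" for v
    using that assms(2) unfolding max_degree_def vd W_def[symmetric] by auto

  \<comment> \<open>The end of smaller degree of such an edge is a separation vertex with at most
    \<open>\<Delta>\<close> neighbours. The factor 2 accounts for the two orientations.\<close>
  have cX: "card X \<le> 2 * k * \<Delta>"
  proof -
    define S where "S = separation_vertices G"
    define U where "U = Sigma S (\<lambda>x. A `` {x})"
    have S: "S \<subseteq> W" by (auto simp: S_def W_def separation_vertices_def)
    then have "finite S" by (rule finite_subset) simp
    then have finU: "finite U" by (simp add: U_def)
    have "card U = (\<Sum>x\<in>S. dg x)"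
      unfolding U_def dg_def using \<open>finite S\<close> by (intro card_SigmaI) auto
    also have "\<dots> \<le> (\<Sum>x\<in>S. \<Delta>)" using S dgle by (intro sum_mono) auto
    finally have cU: "card U \<le> k * \<Delta>" using assms(3) by (simp add: S_def)
    have up: "(x, y) \<in> U" if "(x, y) \<in> A" "dg x < dg y" for x y
      using that sub by (auto simp: U_def S_def separation_vertices_def vd W_def A_def)
    have "X \<subseteq> U \<union> U\<inverse>"
    proof
      fix p assume "p \<in> X"
      then obtain x y where "p = (x, y)" "(x, y) \<in> A" "dg x \<noteq> dg y" by (auto simp: X_def)
      then show "p \<in> U \<union> U\<inverse>"
        using up[of x y] up[of y x] symD[OF sym] by (cases "dg x < dg y") auto
    qed
    then have "card X \<le> card (U \<union> U\<inverse>)" using finU by (intro card_mono) auto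
    also have "\<dots> \<le> card U + card (U\<inverse>)" by (rule card_Un_le)
    finally show ?thesis using cU by (simp add: card_inverse)
  qed

  \<comment> \<open>Arcs leaving \<open>V d\<close> either stay in the class or belong to
    \<open>X\<close>. So the deficiency of \<open>E d\<close> is exactly the number of
    \<open>X\<close>-arcs with tail in \<open>V d\<close>.\<close>
  have arcs_split: "d * card (V d) = card (E d) + card (X \<inter> V d \<times> UNIV)" for d
  proof -
    have "card (Sigma (V d) (\<lambda>v. A `` {v})) = (\<Sum>v\<in>V d. dg v)"
      unfolding dg_def by (intro card_SigmaI) auto
    also have "\<dots> = (\<Sum>v\<in>V d. d)" by (rule sum.cong) (auto simp: V_def)
    also have "Sigma (V d) (\<lambda>v. A `` {v}) = E d \<union> X \<inter> V d \<times> UNIV"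
      using sub by (auto simp: E_def V_def X_def)
    also have "card \<dots> = card (E d) + card (X \<inter> V d \<times> UNIV)"
      by (intro card_Un_disjoint) (simp_all, auto simp: E_def X_def V_def)
    finally show ?thesis by (simp add: mult.commute)
  qed
  have srE: "subregular d (V d) (E d)" for d
    unfolding subregular_def
  proof (intro conjI ballI)
    show "E d \<subseteq> V d \<times> V d" by (auto simp: E_def)
    show "sym (E d)" using sym by (auto simp: E_def sym_def)
    show "irrefl (E d)" using irr by (auto simp: E_def irrefl_def)
    fix v assume "v \<in> V d"
    then have "d = card (A `` {v})" by (simp add: V_def dg_def)
    moreover have "card (E d `` {v}) \<le> card (A `` {v})"
      by (intro card_mono) (auto simp: E_def)
    ultimately show "card (E d `` {v}) \<le> d" by simp
  qed
  have large: "d \<le> 3 \<or> card (E d) > 2 * d\<^sup>2 + 2 * d" if "d \<le> \<Delta>" for d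
  proof (cases "d \<le> 3")
    case False
    have "card (V d) \<ge> 2 * d + d ^ 2 + d ^ 3 + k * fact \<Delta>"
      using assms(4)[of d] that False by (simp add: V_def W_def vd)
    then have "d * (2 * d + d ^ 2 + d ^ 3 + k * fact \<Delta>) \<le> d * card (V d)"
      by (rule mult_le_mono2)
    moreover have "card (X \<inter> V d \<times> UNIV) \<le> card X" by (intro card_mono) auto
    \<comment> \<open>The summand \<open>k * fact \<Delta>\<close> of the hypothesis, multiplied by
      \<open>d\<close>, absorbs all arcs of \<open>X\<close>. What remains is at least
      \<open>2 * d^2 + d * d^2\<close>, which exceeds \<open>2 * d^2 + 2 * d\<close>.\<close>
    moreover have "2 * k * \<Delta> \<le> d * (k * fact \<Delta>)"
    proof -
      have "\<Delta> \<le> fact \<Delta>" by (rule fact_ge_self)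
      then have "2 * (k * \<Delta>) \<le> d * (k * fact \<Delta>)"
        using False by (intro mult_le_mono) auto
      then show ?thesis by simp
    qed
    ultimately have "d * (2 * d + d ^ 2 + d ^ 3) \<le> card (E d)"
      using cX arcs_split[of d] unfolding distrib_left by linarith
    moreover have "2 * d < d * d\<^sup>2"
    proof -
      have "4 * 4 \<le> d * d" using False by (intro mult_le_mono) auto
      then have "2 < d\<^sup>2" by (simp add: power2_eq_square)
      then show ?thesis using False by (simp add: mult.commute)
    qed
    moreover have "d * (2 * d + d ^ 2 + d ^ 3) = 2 * d\<^sup>2 + d * d\<^sup>2 + d * d ^ 3"
      by (simp add: distrib_left power2_eq_square)
    ultimately have "2 * d\<^sup>2 + 2 * d < card (E d)" by linarith
    then show ?thesis ..
  qed simp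

  \<comment> \<open>Choosing a repaired relation for each degree and gluing them to
    \<open>H\<close>\<close>
  have "\<forall>d\<in>{..\<Delta>}. \<exists>E'. E' \<subseteq> V d \<times> V d \<and> sym E' \<and> irrefl E' \<and>
    (\<forall>(x, y)\<in>E'. card (E' `` {x}) = card (E' `` {y})) \<and>
    card (sym_diff (E d) E') \<le> 3 * card (X \<inter> V d \<times> UNIV) + 10 * d"
    \<comment> \<open>Rewriting with \<open>arcs_split\<close> turns the deficiency in the repair
      cost into a count of \<open>X\<close>-arcs.\<close>
    using subregular_repair[OF srE finV large] unfolding arcs_split by simp
  from bchoice[OF this] obtain F where "\<forall>d\<in>{..\<Delta>}. F d \<subseteq> V d \<times> V d \<and> sym (F d) \<and> irrefl (F d) \<and>
    (\<forall>(x, y)\<in>F d. card (F d `` {x}) = card (F d `` {y})) \<and>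
    card (sym_diff (E d) (F d)) \<le> 3 * card (X \<inter> V d \<times> UNIV) + 10 * d" ..
  then have F: "\<And>d. d \<le> \<Delta> \<Longrightarrow> F d \<subseteq> V d \<times> V d"
      "\<And>d. d \<le> \<Delta> \<Longrightarrow> sym (F d)" "\<And>d. d \<le> \<Delta> \<Longrightarrow> irrefl (F d)"
    and Freg: "\<And>d x y. d \<le> \<Delta> \<Longrightarrow> (x, y) \<in> F d \<Longrightarrow> card (F d `` {x}) = card (F d `` {y})"
    and Fdist: "\<And>d. d \<le> \<Delta> \<Longrightarrow>
      card (sym_diff (E d) (F d)) \<le> 3 * card (X \<inter> V d \<times> UNIV) + 10 * d"
    by blast+
  define B where "B = (\<Union>d\<le>\<Delta>. F d)"
  define H where "H = \<lparr>pverts = W, parcs = B\<rparr>"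
  have B_sub: "B \<subseteq> W \<times> W" using F(1) by (fastforce simp: B_def V_def)
  \<comment> \<open>The classes are disjoint, so gluing does not change degrees.\<close>
  have B_Image: "B `` {x} = F d `` {x}" if "x \<in> V d" "d \<le> \<Delta>" for d x
    using F(1) that by (fastforce simp: B_def V_def)
  have "finite B" using B_sub by (rule finite_subset) simp
  have "sym B" using F(2) by (auto simp: B_def sym_def)
  have "irrefl B" using F(3) by (auto simp: B_def irrefl_def)
  have pgH: "pair_graph H"
    using B_sub \<open>finite B\<close> \<open>sym B\<close> \<open>irrefl B\<close>
    by unfold_locales (auto simp: H_def symmetric_def irrefl_def)
  have regH: "disjoint_union_of_regular H"
  proof (rule disjoint_union_of_regularI[OF pgH])
    fix x y assume "(x, y) \<in> parcs H"
    then obtain d where d: "d \<le> \<Delta>" "(x, y) \<in> F d" by (auto simp: H_def B_def)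
    then have "x \<in> V d" "y \<in> V d" using F(1) by auto
    then show "vertex_degree H x = vertex_degree H y"
      using Freg d B_Image by (simp add: vertex_degree_eq_card_Image H_def)
  qed

  \<comment> \<open>Counting the edits\<close>
  have "card (sym_diff A B) \<le> card (X \<union> (\<Union>d\<le>\<Delta>. sym_diff (E d) (F d)))"
  proof (intro card_mono subsetI)
    have "finite (F d)" if "d \<le> \<Delta>" for d using F(1)[OF that] by (rule finite_subset) simp
    then show "finite (X \<union> (\<Union>d\<le>\<Delta>. sym_diff (E d) (F d)))" by auto
    fix p assume p: "p \<in> sym_diff A B"
    obtain x y where xy: "p = (x, y)" by fastforce
    show "p \<in> X \<union> (\<Union>d\<le>\<Delta>. sym_diff (E d) (F d))"
    proof (cases "p \<in> A")
      case True
      then have "x \<in> W" "y \<in> W" "p \<notin> B" using sub p xy by auto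
      then show ?thesis using True dgle[of x]
        \<comment> \<open>A deleted arc outside \<open>X\<close> has both ends in the class of
          degree \<open>dg x\<close>, so it is counted there.\<close>
        by (auto simp: xy X_def E_def V_def B_def)
    next
      case False
      then show ?thesis using p by (auto simp: B_def E_def)
    qed
  qed
  also have "\<dots> \<le> card X + card (\<Union>d\<le>\<Delta>. sym_diff (E d) (F d))" by (rule card_Un_le)
  also have "card (\<Union>d\<le>\<Delta>. sym_diff (E d) (F d)) \<le> (\<Sum>d\<le>\<Delta>. card (sym_diff (E d) (F d)))"
    by (rule card_UN_le) simp
  also have "\<dots> \<le> (\<Sum>d\<le>\<Delta>. 3 * card (X \<inter> V d \<times> UNIV) + 10 * d)"
    using Fdist by (intro sum_mono) auto
  also have "\<dots> = 3 * (\<Sum>d\<le>\<Delta>. card (X \<inter> V d \<times> UNIV)) + 10 * (\<Sum>d\<le>\<Delta>. d)"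
    by (simp add: sum.distrib sum_distrib_left)
  \<comment> \<open>Every arc of \<open>X\<close> has its tail in exactly one class, so the repairs
    cost \<open>3 * card X\<close> in total, on top of the \<open>card X\<close> arcs deleted at the
    start.\<close>
  also have "(\<Sum>d\<le>\<Delta>. card (X \<inter> V d \<times> UNIV)) = card (\<Union>d\<le>\<Delta>. X \<inter> V d \<times> UNIV)"
    by (rule card_UN_disjoint[symmetric]) (auto simp: V_def)
  also have "(\<Union>d\<le>\<Delta>. X \<inter> V d \<times> UNIV) = X"
    using sub dgle by (auto simp: X_def V_def)
  also have "10 * (\<Sum>d\<le>\<Delta>. d) = 5 * \<Delta> * (\<Delta> + 1)"
  proof -
    have "2 * (\<Sum>d\<le>\<Delta>. d) = \<Delta> * (\<Delta> + 1)" by (induction \<Delta>) auto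
    then show ?thesis by simp
  qed
  \<comment> \<open>\<open>4 * card X\<close> is at most \<open>8 * k * \<Delta>\<close>. These are
    arcs; halving them at the end gives the factors 4 and 5 of the claim.\<close>
  finally have D: "card (sym_diff A B) \<le> 8 * (k * \<Delta>) + 5 * \<Delta> * (\<Delta> + 1)" using cX by simp
  have "\<Delta> \<le> fact (\<Delta> + 1)"
    using fact_ge_self[of "\<Delta> + 1"] by linarith
  then have "k * \<Delta> \<le> fact (\<Delta> + 1) * k" by (simp only: mult.commute[of k] mult_le_mono1)
  moreover have "5 * \<Delta> * (\<Delta> + 1) \<le> 10 * \<Delta>\<^sup>2" by (cases \<Delta>) (auto simp: power2_eq_square algebra_simps)
  ultimately have "card (sym_diff A B) \<le> 8 * (fact (\<Delta> + 1) * k) + 10 * \<Delta>\<^sup>2" using D by linarith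
  then have "real (card (sym_diff A B)) \<le> real (8 * (fact (\<Delta> + 1) * k) + 10 * \<Delta>\<^sup>2)"
    by (rule of_nat_mono)
  moreover have "graph_dist G H \<le> 1/2 * card (sym_diff A B)"
    using graph_dist_same_verts_le[of G H] sub B_sub finW unfolding H_def A_def W_def by simp
  ultimately have "graph_dist G H \<le> 4 * fact (\<Delta> + 1) * real k + 5 * real \<Delta> ^ 2"
    by (simp only: of_nat_add of_nat_mult of_nat_numeral of_nat_fact of_nat_power)
  then show ?thesis using pgH regH by (intro exI[of _ H]) (simp add: H_def W_def)
qed

end
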